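(* Let $L=P(\partial/\partial x_1,\dots,\partial/\partial x_n)$ be a weakly hypoelliptic differential operator on $\mathbb{R}^n$ with constant coefficients in $N'\times N$-matrices (acting on functions $\mathbb{R}^n\to\mathbb{R}^N$), and suppose $L$ is weighted homogeneous. Then every bounded $u\in\mathcal{H}(\mathbb{R}^n,L)$ is constant.
   Context: A polynomial $P$ in $n$ real variables with matrix coefficients is weighted homogeneous with weight $w=(w_1,\dots,w_n)$, $w_j>0$, if there is $k$ such that $P(t^{w_1}x_1,\dots,t^{w_n}x_n)=t^kP(x_1,\dots,x_n)$ for all $t>0$ and $x\in\mathbb{R}^n$; the operator $P(\partial/\partial x)$ is then called weighted homogeneous. $L$ is weakly hypoelliptic if for every open $\Omega\subset\mathbb{R}^n$, every distributional solution $u\in\mathcal{D}'(\Omega,\mathbb{R}^N)$ of $Lu=0$ is smooth. $\mathcal{H}(\mathbb{R}^n,L)\subset C^\infty(\mathbb{R}^n,\mathbb{R}^N)$ denotes the space of distributional solutions of $Lu=0$ on $\mathbb{R}^n$. *)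

theory Defs
  imports "HOL-Analysis.Analysis"
begin

definition partial :: "'n::finite \<Rightarrow> (real^'n \<Rightarrow> 'b::real_normed_vector) \<Rightarrow> real^'n \<Rightarrow> 'b" where
  "partial i f x = vector_derivative (\<lambda>t. f (x + t *\<^sub>R axis i 1)) (at 0)"

fun derivs :: "'n::finite list \<Rightarrow> (real^'n \<Rightarrow> 'b::real_normed_vector) \<Rightarrow> real^'n \<Rightarrow> 'b" where
  "derivs [] f = f"
| "derivs (i # is) f = partial i (derivs is f)"

definition smooth_on :: "(real^'n::finite) set \<Rightarrow> (real^'n \<Rightarrow> 'b::real_normed_vector) \<Rightarrow> bool" where
  "smooth_on S f \<longleftrightarrow>
     (\<forall>ds. continuous_on S (derivs ds f) \<and>
        (\<forall>i. \<forall>x\<in>S. (\<lambda>t. derivs ds f (x + t *\<^sub>R axis i 1)) differentiable (at 0)))"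

text \<open>Multi-indices alpha :: 'n => nat; the derivative of order alpha
  (order of differentiation is irrelevant for smooth functions).\<close>
definition Dalpha :: "('n::finite \<Rightarrow> nat) \<Rightarrow> (real^'n \<Rightarrow> 'b::real_normed_vector) \<Rightarrow> real^'n \<Rightarrow> 'b" where
  "Dalpha \<alpha> f = derivs (SOME ds. \<forall>i. count_list ds i = \<alpha> i) f"

definition mi_order :: "('n::finite \<Rightarrow> nat) \<Rightarrow> nat" where
  "mi_order \<alpha> = (\<Sum>i\<in>UNIV. \<alpha> i)"

definition tsupp :: "(real^'n::finite \<Rightarrow> real) \<Rightarrow> (real^'n) set" where
  "tsupp \<phi> = closure {x. \<phi> x \<noteq> 0}"

definition test_fun :: "(real^'n::finite) set \<Rightarrow> (real^'n \<Rightarrow> real) \<Rightarrow> bool" where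
  "test_fun \<Omega> \<phi> \<longleftrightarrow> smooth_on UNIV \<phi> \<and> compact (tsupp \<phi>) \<and> tsupp \<phi> \<subseteq> \<Omega>"

definition distribution :: "(real^'n::finite) set \<Rightarrow> ((real^'n \<Rightarrow> real) \<Rightarrow> real) \<Rightarrow> bool" where
  "distribution \<Omega> T \<longleftrightarrow>
     (\<forall>\<phi> \<psi> a b. test_fun \<Omega> \<phi> \<longrightarrow> test_fun \<Omega> \<psi> \<longrightarrow>
         T (\<lambda>x. a * \<phi> x + b * \<psi> x) = a * T \<phi> + b * T \<psi>) \<and>
     (\<forall>K. compact K \<and> K \<subseteq> \<Omega> \<longrightarrow>
        (\<exists>C m. \<forall>\<phi>. test_fun \<Omega> \<phi> \<and> tsupp \<phi> \<subseteq> K \<longrightarrow>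
           \<bar>T \<phi>\<bar> \<le> C * (\<Sum>ds\<in>{ds. length ds \<le> m}. (SUP x. \<bar>derivs ds \<phi> x\<bar>))))"

definition vdistribution :: "(real^'n::finite) set \<Rightarrow> ((real^'n \<Rightarrow> real) \<Rightarrow> real^'m::finite) \<Rightarrow> bool" where
  "vdistribution \<Omega> u \<longleftrightarrow> (\<forall>j. distribution \<Omega> (\<lambda>\<phi>. u \<phi> $ j))"

text \<open>An operator P(d/dx) is given by its coefficient function on multi-indices
  (N' x N matrices, real^'m^'k), with finite support.\<close>
definition poly_coeffs :: "(('n::finite \<Rightarrow> nat) \<Rightarrow> real^'m::finite^'k::finite) \<Rightarrow> bool" where
  "poly_coeffs P \<longleftrightarrow> finite {\<alpha>. P \<alpha> \<noteq> 0}"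

definition poly_eval :: "(('n::finite \<Rightarrow> nat) \<Rightarrow> real^'m::finite^'k::finite) \<Rightarrow> real^'n \<Rightarrow> real^'m^'k" where
  "poly_eval P \<xi> = (\<Sum>\<alpha>\<in>{\<alpha>. P \<alpha> \<noteq> 0}. (\<Prod>i\<in>UNIV. (\<xi> $ i) ^ \<alpha> i) *\<^sub>R P \<alpha>)"

definition weighted_homogeneous :: "(('n::finite \<Rightarrow> nat) \<Rightarrow> real^'m::finite^'k::finite) \<Rightarrow> bool" where
  "weighted_homogeneous P \<longleftrightarrow>
     (\<exists>w::real^'n. (\<forall>i. w $ i > 0) \<and> (\<exists>k::real. \<forall>t>0. \<forall>x.
        poly_eval P (\<chi> i. t powr (w $ i) * x $ i) = t powr k *\<^sub>R poly_eval P x))"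

definition dist_solution :: "(('n::finite \<Rightarrow> nat) \<Rightarrow> real^'m::finite^'k::finite) \<Rightarrow> (real^'n) set
     \<Rightarrow> ((real^'n \<Rightarrow> real) \<Rightarrow> real^'m) \<Rightarrow> bool" where
  "dist_solution P \<Omega> u \<longleftrightarrow>
     (\<forall>\<phi>. test_fun \<Omega> \<phi> \<longrightarrow>
        (\<Sum>\<alpha>\<in>{\<alpha>. P \<alpha> \<noteq> 0}. ((-1) ^ mi_order \<alpha>) *\<^sub>R (P \<alpha> *v u (Dalpha \<alpha> \<phi>))) = 0)"

definition fun_dist :: "(real^'n::finite) set \<Rightarrow> (real^'n \<Rightarrow> real^'m::finite) \<Rightarrow> (real^'n \<Rightarrow> real) \<Rightarrow> real^'m" where
  "fun_dist \<Omega> f \<phi> = integral \<Omega> (\<lambda>x. \<phi> x *\<^sub>R f x)"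

definition weakly_hypoelliptic :: "(('n::finite \<Rightarrow> nat) \<Rightarrow> real^'m::finite^'k::finite) \<Rightarrow> bool" where
  "weakly_hypoelliptic P \<longleftrightarrow>
     (\<forall>\<Omega> (u :: (real^'n \<Rightarrow> real) \<Rightarrow> real^'m). open \<Omega> \<longrightarrow> vdistribution \<Omega> u \<longrightarrow> dist_solution P \<Omega> u \<longrightarrow>
        (\<exists>f. smooth_on \<Omega> f \<and> (\<forall>\<phi>. test_fun \<Omega> \<phi> \<longrightarrow> u \<phi> = fun_dist \<Omega> f \<phi>)))"

definition sol_space :: "(('n::finite \<Rightarrow> nat) \<Rightarrow> real^'m::finite^'k::finite) \<Rightarrow> (real^'n \<Rightarrow> real^'m) set" where
  "sol_space P = {f. smooth_on UNIV f \<and> dist_solution P UNIV (fun_dist UNIV f)}"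

end

theory Submission
  imports Defs
begin

text \<open>
  Suppose that a bounded solution u is not constant on some line parallel to the axis of index i,
  say through a. Weighted homogeneity and translation invariance make each
  u (a + (t powr w) x) a solution, where t powr w acts diagonally. Hence so is the uniformly
  convergent lacunary sum v x of the terms (eps ^ k) u (a + (t_k powr w) x), where t_k is chosen
  so that the axis of index i is stretched by R ^ k. Weak hypoellipticity forces v to be smooth,
  but along that axis v is a Weierstrass-type series whose difference quotients at 0 are unbounded
  for suitable eps and R.
\<close>

subsection \<open>Test functions\<close>

text \<open>A plain scaling argument needs an a priori bound of derivatives by the supremum, which
  one would extract from weak hypoellipticity by a Baire or closed graph argument. The series
  replaces that bound: it collects rescalings of one solution at all scales into a single solution
  that would violate it. Only the stretching along one axis has to be controlled. The other
  coordinates may be stretched at any rate, since a bound on u is invariant under every change of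
  variables. Two gaps remain. Solutions are defined through the coefficients of P, whereas
  homogeneity is an identity between values of P, so it has to be transferred to single monomials.
  And hypoellipticity gives a smooth function that agrees with v only as a distribution; identifying
  the two pointwise needs a test function concentrated near a given point, which is why bump
  functions are constructed.\<close>

lemma partial_eq_of_has_vector_derivative:
  assumes "((\<lambda>t. f (x + t *\<^sub>R axis i 1)) has_vector_derivative D) (at 0)"
  shows "partial i f x = D"
  unfolding partial_def using assms by (rule vector_derivative_at)

lemma smooth_on_UNIV_D:
  assumes "smooth_on UNIV f"
  shows "continuous_on UNIV (derivs ds f)"
    and "((\<lambda>t. derivs ds f (x + t *\<^sub>R axis i 1)) has_vector_derivative
          partial i (derivs ds f) x) (at 0)"
  using assms unfolding smooth_on_def partial_def by (auto simp: vector_derivative_works[symmetric])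

lemma smooth_on_UNIV_I:
  assumes "\<And>ds. continuous_on UNIV (derivs ds f)"
    and "\<And>ds i x. ((\<lambda>t. derivs ds f (x + t *\<^sub>R axis i 1)) has_vector_derivative
          D ds i x) (at 0)"
  shows "smooth_on UNIV f"
  unfolding smooth_on_def using assms differentiableI_vector by blast

lemma smooth_on_UNIV_continuous: "smooth_on UNIV f \<Longrightarrow> continuous_on UNIV f"
  using smooth_on_UNIV_D(1)[of f "[]"] by simp

text \<open>Translation to the base point and anisotropic dilation are kept in one map, because the
  family of such maps with nonzero factors is closed under inversion.\<close>

definition dil :: "real^'n::finite \<Rightarrow> real^'n \<Rightarrow> real^'n \<Rightarrow> real^'n" where
  "dil a c x = (\<chi> i. a $ i + c $ i * x $ i)"

lemma dil_nth [simp]: "dil a c x $ i = a $ i + c $ i * x $ i"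
  by (simp add: dil_def)

lemma continuous_on_dil [continuous_intros]:
  "continuous_on S g \<Longrightarrow> continuous_on S (\<lambda>x. dil a c (g x))"
  unfolding dil_def by (intro continuous_intros)

lemma dil_add_axis: "dil a c (x + t *\<^sub>R axis i 1) = dil a c x + (c $ i * t) *\<^sub>R axis i 1"
  by (simp add: vec_eq_iff axis_def algebra_simps)

lemma has_vector_derivative_dil:
  assumes "((\<lambda>t. f (dil a c x + t *\<^sub>R axis i 1)) has_vector_derivative D) (at 0)"
  shows "((\<lambda>t. f (dil a c (x + t *\<^sub>R axis i 1))) has_vector_derivative c $ i *\<^sub>R D) (at 0)"
proof -
  have "((\<lambda>t. c $ i * t) has_vector_derivative c $ i) (at 0)"
    by (auto intro!: derivative_eq_intros simp: has_vector_derivative_def)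
  then have "((\<lambda>t. f (dil a c x + t *\<^sub>R axis i 1)) \<circ> (\<lambda>t. c $ i * t)
      has_vector_derivative c $ i *\<^sub>R D) (at 0)"
    by (rule vector_diff_chain_at) (use assms in simp)
  then show ?thesis
    by (simp add: o_def dil_add_axis)
qed

lemma derivs_dil:
  assumes "smooth_on UNIV f"
  shows "derivs ds (\<lambda>x. f (dil a c x)) =
    (\<lambda>x. prod_list (map (($) c) ds) *\<^sub>R derivs ds f (dil a c x))"
proof (induction ds)
  case (Cons i ds)
  show ?case
  proof
    fix x
    have "((\<lambda>t. derivs ds f (dil a c (x + t *\<^sub>R axis i 1))) has_vector_derivative
            c $ i *\<^sub>R partial i (derivs ds f) (dil a c x)) (at 0)"
      by (intro has_vector_derivative_dil smooth_on_UNIV_D assms)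
    then have "((\<lambda>t. prod_list (map (($) c) ds) *\<^sub>R derivs ds f (dil a c (x + t *\<^sub>R axis i 1)))
        has_vector_derivative
        prod_list (map (($) c) ds) *\<^sub>R c $ i *\<^sub>R partial i (derivs ds f) (dil a c x)) (at 0)"
      by (intro bounded_linear.has_vector_derivative[OF bounded_linear_scaleR_right])
    then show "derivs (i # ds) (\<lambda>x. f (dil a c x)) x =
        prod_list (map (($) c) (i # ds)) *\<^sub>R derivs (i # ds) f (dil a c x)"
      by (simp add: Cons partial_eq_of_has_vector_derivative mult.commute)
  qed
qed simp

lemma smooth_on_dil:
  assumes "smooth_on UNIV f"
  shows "smooth_on UNIV (\<lambda>x. f (dil a c x))"
proof (rule smooth_on_UNIV_I)
  fix ds
  have "continuous_on UNIV (\<lambda>x. derivs ds f (dil a c x))"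
    using continuous_on_compose2[OF smooth_on_UNIV_D(1)[OF assms] continuous_on_dil[OF continuous_on_id]]
    by auto
  then show "continuous_on UNIV (derivs ds (\<lambda>x. f (dil a c x)))"
    unfolding derivs_dil[OF assms] by (intro continuous_intros)
  show "((\<lambda>t. derivs ds (\<lambda>x. f (dil a c x)) (x + t *\<^sub>R axis i 1)) has_vector_derivative
      prod_list (map (($) c) ds) *\<^sub>R c $ i *\<^sub>R partial i (derivs ds f) (dil a c x)) (at 0)" for i x
    unfolding derivs_dil[OF assms]
    by (intro bounded_linear.has_vector_derivative[OF bounded_linear_scaleR_right] has_vector_derivative_dil smooth_on_UNIV_D assms)
qed

lemma dil_inverse:
  assumes "\<And>i. c $ i \<noteq> 0"
  shows "dil a c (dil (\<chi> i. - a $ i / c $ i) (\<chi> i. 1 / c $ i) x) = x"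
    and "dil (\<chi> i. - a $ i / c $ i) (\<chi> i. 1 / c $ i) (dil a c x) = x"
  using assms by (simp_all add: vec_eq_iff field_simps)

lemma test_fun_dil:
  assumes "test_fun UNIV \<phi>" and c: "\<And>i. c $ i \<noteq> 0"
  shows "test_fun UNIV (\<lambda>x. \<phi> (dil a c x))"
proof -
  let ?g = "dil (\<chi> i. - a $ i / c $ i) (\<chi> i. 1 / c $ i)"
  have K: "compact (?g ` tsupp \<phi>)"
    using assms by (auto simp: test_fun_def intro!: compact_continuous_image continuous_intros)
  have "x \<in> ?g ` tsupp \<phi>" if "\<phi> (dil a c x) \<noteq> 0" for x
  proof
    show "x = ?g (dil a c x)" using dil_inverse(2)[OF c] by simp
    show "dil a c x \<in> tsupp \<phi>" using that by (auto simp: tsupp_def intro: closure_subset[THEN subsetD])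
  qed
  then have "{x. \<phi> (dil a c x) \<noteq> 0} \<subseteq> ?g ` tsupp \<phi>" by blast
  then have "tsupp (\<lambda>x. \<phi> (dil a c x)) \<subseteq> ?g ` tsupp \<phi>"
    unfolding tsupp_def[of "\<lambda>x. \<phi> (dil a c x)"]
    using compact_imp_closed[OF K] by (rule closure_minimal)
  moreover have "closed (tsupp (\<lambda>x. \<phi> (dil a c x)))" by (simp add: tsupp_def)
  ultimately have "compact (tsupp (\<lambda>x. \<phi> (dil a c x)))"
    using compact_Int_closed[OF K, of "tsupp (\<lambda>x. \<phi> (dil a c x))"] Int_absorb1 by fastforce
  then show ?thesis
    using assms smooth_on_dil by (auto simp: test_fun_def)
qed

text \<open>The complement of the closed support is open, so a short segment along any axis stays
  inside it and the difference quotients vanish there. No smoothness enters.\<close>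

lemma derivs_eq_0_outside_tsupp:
  "x \<notin> tsupp \<phi> \<Longrightarrow> derivs ds \<phi> x = 0"
proof (induction ds arbitrary: x)
  case Nil
  then show ?case using closure_subset[of "{x. \<phi> x \<noteq> 0}"] by (auto simp: tsupp_def)
next
  case (Cons i ds)
  have "open ((\<lambda>t. x + t *\<^sub>R axis i 1) -` (- tsupp \<phi>))"
    by (intro open_vimage continuous_intros) (simp add: tsupp_def)
  moreover have "0 \<in> (\<lambda>t. x + t *\<^sub>R axis i 1) -` (- tsupp \<phi>)"
    using Cons.prems by simp
  ultimately have "((\<lambda>t. derivs ds \<phi> (x + t *\<^sub>R axis i 1)) has_vector_derivative 0) (at 0)"
    by (rule has_vector_derivative_transform_within_open[where f = "\<lambda>t. 0", rotated])
      (use Cons.IH in auto)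
  then show ?case by (simp add: partial_eq_of_has_vector_derivative)
qed

text \<open>Justifies the choice operator in \<open>Dalpha\<close>: some list of directions realises
  every multi-index.\<close>

lemma exists_list_count_eq: "\<exists>ds. \<forall>i. count_list ds i = \<alpha> (i :: 'n::finite)"
proof -
  obtain ds where "mset ds = (\<Sum>i\<in>UNIV. replicate_mset (\<alpha> i) i)"
    using ex_mset by blast
  then have "count_list ds i = \<alpha> i" for i
    by (simp add: count_mset[symmetric] count_sum)
  then show ?thesis by blast
qed

text \<open>The list chosen by \<open>Dalpha\<close> depends on \<alpha> alone, so both sides use
  the same one, and the chain rule factor only counts its entries. Symmetry of mixed partial
  derivatives is never invoked.\<close>

lemma Dalpha_dil:
  assumes "smooth_on UNIV \<phi>"
  shows "Dalpha \<alpha> (\<lambda>x. \<phi> (dil a c x)) =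
    (\<lambda>x. (\<Prod>i\<in>UNIV. (c $ i) ^ \<alpha> i) *\<^sub>R Dalpha \<alpha> \<phi> (dil a c x))"
proof -
  define ds where "ds = (SOME ds. \<forall>i. count_list ds i = \<alpha> i)"
  have ds: "\<forall>i. count_list ds i = \<alpha> i"
    unfolding ds_def by (rule someI_ex, rule exists_list_count_eq)
  have "prod_list (map (($) c) ds) = (\<Prod>i\<in>UNIV. (c $ i) ^ count_list ds i)"
  proof (induction ds)
    case (Cons j ds)
    have "(\<Prod>i\<in>UNIV. (c $ i) ^ count_list (j # ds) i) =
        (\<Prod>i\<in>UNIV. (if i = j then c $ j else 1) * (c $ i) ^ count_list ds i)"
      by (intro prod.cong) auto
    then show ?case by (simp add: Cons prod.distrib)
  qed simp
  then show ?thesis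
    using ds by (simp add: Dalpha_def ds_def[symmetric] derivs_dil[OF assms])
qed

subsection \<open>Functions as distributions\<close>

text \<open>Passes from the gauge integral in \<open>fun_dist\<close> to the Lebesgue integral,
  where norm estimates and changes of variables are carried out.\<close>

lemma integral_compact_support:
  fixes F :: "real^'n::finite \<Rightarrow> 'b::euclidean_space"
  assumes "continuous_on UNIV F" "compact K" "\<And>x. x \<notin> K \<Longrightarrow> F x = 0"
  shows "integrable lborel F" and "integral UNIV F = integral\<^sup>L lborel F"
proof -
  have "integrable lborel (\<lambda>x. indicator K x *\<^sub>R F x)"
    using assms by (intro borel_integrable_compact) (auto intro: continuous_on_subset)
  moreover have "(\<lambda>x. indicator K x *\<^sub>R F x) = F"
    using assms(3) by (auto simp: indicator_def)
  ultimately show "integrable lborel F" by simp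
  then show "integral UNIV F = integral\<^sup>L lborel F"
    by (rule integral_lborel)
qed

lemma integral_dil:
  fixes F :: "real^'n::finite \<Rightarrow> 'b::euclidean_space"
  assumes "continuous_on UNIV F" and c: "\<And>i. c $ i \<noteq> 0"
  shows "integral\<^sup>L lborel F = (\<Prod>i\<in>UNIV. \<bar>c $ i\<bar>) *\<^sub>R (\<integral>x. F (dil a c x) \<partial>lborel)"
proof -
  let ?T = "\<lambda>x. a + (\<Sum>j\<in>Basis. ((c \<bullet> j) * (x \<bullet> j)) *\<^sub>R j)"
  have B: "(Basis :: (real^'n) set) = range (\<lambda>i. axis i 1)"
    by (auto simp: Basis_vec_def)
  have inj: "inj (\<lambda>i::'n. axis i (1::real))" by (auto simp: inj_def axis_eq_axis)
  have T: "?T = dil a c"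
  proof
    fix x
    have "?T x = a + (\<Sum>k\<in>UNIV. (c $ k * x $ k) *\<^sub>R axis k 1)"
      by (simp add: B sum.reindex[OF inj] inner_axis)
    then show "?T x = dil a c x"
      by (simp add: vec_eq_iff axis_def if_distrib cong: if_cong)
  qed
  have C: "(\<Prod>j\<in>Basis. \<bar>c \<bullet> j\<bar>) = (\<Prod>i\<in>UNIV. \<bar>c $ i\<bar>)"
    by (simp add: B prod.reindex[OF inj] inner_axis)
  have [measurable]: "dil a c \<in> borel_measurable borel" "F \<in> borel_measurable borel"
    using assms by (auto intro!: borel_measurable_continuous_onI continuous_intros)
  have "c \<bullet> j \<noteq> 0" if "j \<in> Basis" for j
    using c that by (auto simp: B inner_axis)
  \<comment> \<open>The affine transformation formula is indexed by \<open>Basis\<close>;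
    \<open>T\<close> and \<open>C\<close> are its map and Jacobian rewritten over
    coordinates.\<close>
  from lborel_affine_euclidean[of "\<lambda>j. c \<bullet> j" a, OF this]
  have "integral\<^sup>L lborel F = integral\<^sup>L (density (distr lborel borel ?T) (\<lambda>_. (\<Prod>j\<in>Basis. \<bar>c \<bullet> j\<bar>))) F"
    by (rule arg_cong[where f = "\<lambda>M. integral\<^sup>L M F"])
  also have "\<dots> = (\<integral>x. (\<Prod>i\<in>UNIV. \<bar>c $ i\<bar>) *\<^sub>R F x \<partial>distr lborel borel (dil a c))"
    unfolding T C by (subst integral_density) (auto intro!: prod_nonneg)
  also have "\<dots> = (\<integral>x. (\<Prod>i\<in>UNIV. \<bar>c $ i\<bar>) *\<^sub>R F (dil a c x) \<partial>lborel)"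
    by (subst integral_distr) auto
  finally show ?thesis by simp
qed

text \<open>Stated for all iterated derivatives of a test function, so that a derivative never has
  to be recognised as a test function itself.\<close>

lemma test_fun_derivs:
  fixes v :: "real^'n::finite \<Rightarrow> 'b::euclidean_space"
  assumes "test_fun UNIV \<phi>" "continuous_on UNIV v"
  shows "continuous_on UNIV (\<lambda>x. derivs ds \<phi> x *\<^sub>R v x)"
    and "integrable lborel (\<lambda>x. derivs ds \<phi> x *\<^sub>R v x)"
    and "integral UNIV (\<lambda>x. derivs ds \<phi> x *\<^sub>R v x) = (\<integral>x. derivs ds \<phi> x *\<^sub>R v x \<partial>lborel)"
proof -
  show c: "continuous_on UNIV (\<lambda>x. derivs ds \<phi> x *\<^sub>R v x)"
    using assms by (intro continuous_intros smooth_on_UNIV_D(1)) (auto simp: test_fun_def)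
  have K: "compact (tsupp \<phi>)" using assms by (simp add: test_fun_def)
  show "integrable lborel (\<lambda>x. derivs ds \<phi> x *\<^sub>R v x)"
    "integral UNIV (\<lambda>x. derivs ds \<phi> x *\<^sub>R v x) = (\<integral>x. derivs ds \<phi> x *\<^sub>R v x \<partial>lborel)"
    by (rule integral_compact_support[OF c K]; simp add: derivs_eq_0_outside_tsupp)+
qed

lemma fun_dist_derivs:
  fixes v :: "real^'n::finite \<Rightarrow> real^'m::finite"
  assumes "test_fun UNIV \<phi>" "continuous_on UNIV v"
  shows "fun_dist UNIV v (derivs ds \<phi>) = (\<integral>x. derivs ds \<phi> x *\<^sub>R v x \<partial>lborel)"
  using test_fun_derivs(3)[OF assms] by (simp add: fun_dist_def)

lemma fun_dist_derivs_add_scaleR: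
  fixes f g :: "real^'n::finite \<Rightarrow> real^'m::finite"
  assumes "test_fun UNIV \<phi>" "continuous_on UNIV f" "continuous_on UNIV g"
  shows "fun_dist UNIV (\<lambda>x. f x + r *\<^sub>R g x) (derivs ds \<phi>) =
    fun_dist UNIV f (derivs ds \<phi>) + r *\<^sub>R fun_dist UNIV g (derivs ds \<phi>)"
proof -
  have "fun_dist UNIV (\<lambda>x. f x + r *\<^sub>R g x) (derivs ds \<phi>) =
      (\<integral>x. derivs ds \<phi> x *\<^sub>R f x + r *\<^sub>R (derivs ds \<phi> x *\<^sub>R g x) \<partial>lborel)"
    using assms by (subst fun_dist_derivs)
      (auto intro!: continuous_intros simp: algebra_simps)
  also have "\<dots> = (\<integral>x. derivs ds \<phi> x *\<^sub>R f x \<partial>lborel) + r *\<^sub>R (\<integral>x. derivs ds \<phi> x *\<^sub>R g x \<partial>lborel)"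
    using test_fun_derivs(2)[OF assms(1,2)] test_fun_derivs(2)[OF assms(1,3)]
    by (simp add: Bochner_Integration.integral_add del: scaleR_scaleR)
  finally show ?thesis using assms by (simp add: fun_dist_derivs)
qed

section \<open>Stability of solutions under sums, uniform limits and dilations\<close>

lemma dist_solution_add_scaleR:
  fixes f g :: "real^'n::finite \<Rightarrow> real^'m::finite"
  assumes "dist_solution P UNIV (fun_dist UNIV f)" "dist_solution P UNIV (fun_dist UNIV g)"
    and "continuous_on UNIV f" "continuous_on UNIV g"
  shows "dist_solution P UNIV (fun_dist UNIV (\<lambda>x. f x + r *\<^sub>R g x))"
  unfolding dist_solution_def
proof (intro allI impI)
  fix \<phi> :: "real^'n \<Rightarrow> real" assume \<phi>: "test_fun UNIV \<phi>"
  let ?S = "\<lambda>h. \<Sum>\<alpha>\<in>{\<alpha>. P \<alpha> \<noteq> 0}. (-1) ^ mi_order \<alpha> *\<^sub>R (P \<alpha> *v fun_dist UNIV h (Dalpha \<alpha> \<phi>))"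
  have "?S (\<lambda>x. f x + r *\<^sub>R g x) = ?S f + r *\<^sub>R ?S g"
    by (simp add: Dalpha_def fun_dist_derivs_add_scaleR[OF \<phi> assms(3,4)]
        matrix_vector_right_distrib vec.scale scaleR_add_right sum.distrib scaleR_sum_right
        matrix_vector_mult_scaleR mult.commute)
  also have "\<dots> = 0"
    using assms(1,2) \<phi> by (simp add: dist_solution_def)
  finally show "?S (\<lambda>x. f x + r *\<^sub>R g x) = 0" .
qed

lemma dist_solution_zero: "dist_solution P UNIV (fun_dist UNIV (\<lambda>x. 0))"
  by (simp add: dist_solution_def fun_dist_def)

lemma dist_solution_sum:
  fixes f :: "nat \<Rightarrow> real^'n::finite \<Rightarrow> real^'m::finite"
  assumes "\<And>k. dist_solution P UNIV (fun_dist UNIV (f k))" "\<And>k. continuous_on UNIV (f k)"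
  shows "dist_solution P UNIV (fun_dist UNIV (\<lambda>x. \<Sum>k<K. r k *\<^sub>R f k x))"
proof (induction K)
  case 0
  show ?case using dist_solution_zero by simp
next
  case (Suc K)
  show ?case unfolding sum.lessThan_Suc
    by (rule dist_solution_add_scaleR[OF Suc assms(1)]) (intro continuous_intros assms)+
qed

text \<open>All derivatives fall on the test function, so the pairing changes by at most the uniform
  distance times the L1 norm of a fixed derivative of \<phi>. No convergence of derivatives of
  \<open>f k\<close> is required.\<close>

lemma dist_solution_uniform_limit:
  fixes f :: "nat \<Rightarrow> real^'n::finite \<Rightarrow> real^'m::finite"
  assumes sol: "\<And>k. dist_solution P UNIV (fun_dist UNIV (f k))"
    and cont: "\<And>k. continuous_on UNIV (f k)"
    and lim: "uniform_limit UNIV f v sequentially"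
  shows "dist_solution P UNIV (fun_dist UNIV v)"
  unfolding dist_solution_def
proof (intro allI impI)
  fix \<phi> :: "real^'n \<Rightarrow> real" assume \<phi>: "test_fun UNIV \<phi>"
  have v: "continuous_on UNIV v"
    using uniform_limit_theorem[OF _ lim] cont by simp
  have conv: "(\<lambda>k. fun_dist UNIV (f k) (derivs ds \<phi>)) \<longlonglongrightarrow> fun_dist UNIV v (derivs ds \<phi>)" for ds
  proof -
    let ?d = "derivs ds \<phi>"
    have d: "integrable lborel (\<lambda>x. norm (?d x))"
      using test_fun_derivs(2)[OF \<phi>, of "\<lambda>x. 1::real" ds] integrable_norm[of lborel ?d] by auto
    define I where "I = (\<integral>x. norm (?d x) \<partial>lborel)"
    have bound: "norm (fun_dist UNIV (f k) ?d - fun_dist UNIV v ?d) \<le> e * I"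
      if "\<And>x. dist (f k x) (v x) \<le> e" for k e
    proof -
      have "fun_dist UNIV (f k) ?d - fun_dist UNIV v ?d = (\<integral>x. ?d x *\<^sub>R f k x - ?d x *\<^sub>R v x \<partial>lborel)"
        using test_fun_derivs(2)[OF \<phi> cont] test_fun_derivs(2)[OF \<phi> v] cont v
        by (simp add: fun_dist_derivs[OF \<phi>] Bochner_Integration.integral_diff)
      also have "norm \<dots> \<le> (\<integral>x. e * norm (?d x) \<partial>lborel)"
      proof (rule Bochner_Integration.integral_norm_bound_integral)
        show "integrable lborel (\<lambda>x. ?d x *\<^sub>R f k x - ?d x *\<^sub>R v x)"
          using test_fun_derivs(2)[OF \<phi> cont] test_fun_derivs(2)[OF \<phi> v] by simp
        show "norm (?d x *\<^sub>R f k x - ?d x *\<^sub>R v x) \<le> e * norm (?d x)" for x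
          using mult_right_mono[OF that[of x], of "norm (?d x)"]
          by (simp add: dist_norm scaleR_diff_right[symmetric] mult.commute)
      qed (use d in simp)
      finally show ?thesis by (simp add: I_def)
    qed
    have "I \<ge> 0" by (simp add: I_def)
    show ?thesis
    proof (rule LIMSEQ_I)
      fix e :: real assume "e > 0"
      \<comment> \<open>\<open>I\<close> may be zero; adding 1 keeps the quotient meaningful and
        makes the final inequality strict.\<close>
      then have "e / (I + 1) > 0" using \<open>I \<ge> 0\<close> by simp
      then obtain K where K: "\<And>k x. k \<ge> K \<Longrightarrow> dist (f k x) (v x) < e / (I + 1)"
        using lim unfolding uniform_limit_iff eventually_sequentially by (metis UNIV_I)
      have "norm (fun_dist UNIV (f k) ?d - fun_dist UNIV v ?d) < e" if "k \<ge> K" for k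
      proof -
        have "norm (fun_dist UNIV (f k) ?d - fun_dist UNIV v ?d) \<le> e / (I + 1) * I"
          using K[OF that] by (intro bound) (simp add: less_imp_le)
        also have "\<dots> < e" using \<open>e > 0\<close> \<open>I \<ge> 0\<close> by (simp add: field_simps)
        finally show ?thesis .
      qed
      then show "\<exists>K. \<forall>k\<ge>K. norm (fun_dist UNIV (f k) ?d - fun_dist UNIV v ?d) < e" by blast
    qed
  qed
  let ?S = "\<lambda>h. \<Sum>\<alpha>\<in>{\<alpha>. P \<alpha> \<noteq> 0}. (-1) ^ mi_order \<alpha> *\<^sub>R (P \<alpha> *v fun_dist UNIV h (Dalpha \<alpha> \<phi>))"
  have "(\<lambda>k. ?S (f k)) \<longlonglongrightarrow> ?S v"
    unfolding Dalpha_def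
    by (intro tendsto_sum tendsto_scaleR tendsto_const conv
        bounded_linear.tendsto[OF matrix_vector_mul_bounded_linear])
  moreover have "?S (f k) = 0" for k
    using sol \<phi> by (simp add: dist_solution_def)
  ultimately show "?S v = 0" by (simp add: LIMSEQ_const_iff)
qed

text \<open>A change of variables moves the dilation onto the test function. Every monomial of P
  then picks up the same factor, so the whole equation is merely multiplied by a constant.\<close>

lemma dist_solution_dil:
  fixes u :: "real^'n::finite \<Rightarrow> real^'m::finite"
  assumes sol: "dist_solution P UNIV (fun_dist UNIV u)" and u: "continuous_on UNIV u"
    and c: "\<And>i. c $ i \<noteq> 0"
    and \<kappa>: "\<And>\<alpha>. P \<alpha> \<noteq> 0 \<Longrightarrow> (\<Prod>i\<in>UNIV. (c $ i) ^ \<alpha> i) = \<kappa>"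
  shows "dist_solution P UNIV (fun_dist UNIV (\<lambda>x. u (dil a c x)))"
  unfolding dist_solution_def
proof (intro allI impI)
  fix \<phi> :: "real^'n \<Rightarrow> real" assume \<phi>: "test_fun UNIV \<phi>"
  define \<psi> where "\<psi> = (\<lambda>x. \<phi> (dil (\<chi> i. - a $ i / c $ i) (\<chi> i. 1 / c $ i) x))"
  have \<psi>: "test_fun UNIV \<psi>"
    unfolding \<psi>_def using \<phi> c by (intro test_fun_dil) auto
  have \<phi>_eq: "\<phi> = (\<lambda>x. \<psi> (dil a c x))"
    using dil_inverse(2)[OF c] by (simp add: \<psi>_def)
  define D where "D = (\<Prod>i\<in>UNIV. \<bar>c $ i\<bar>)"
  have D: "D \<noteq> 0" using c by (simp add: D_def)
  have "continuous_on UNIV (\<lambda>x. u (dil a c x))"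
    using continuous_on_compose2[OF u continuous_on_dil[OF continuous_on_id]] by simp
  \<comment> \<open>\<kappa> is the chain rule factor of
    \<open>\<phi> = \<psi> \<circ> dil a c\<close>, and \<open>1 / D\<close> is the Jacobian of the
    inverse map.\<close>
  then have fd: "fun_dist UNIV (\<lambda>x. u (dil a c x)) (Dalpha \<alpha> \<phi>) =
      (\<kappa> / D) *\<^sub>R fun_dist UNIV u (Dalpha \<alpha> \<psi>)" if "P \<alpha> \<noteq> 0" for \<alpha>
  proof -
    assume u': "continuous_on UNIV (\<lambda>x. u (dil a c x))"
    have \<psi>': "smooth_on UNIV \<psi>" using \<psi> by (simp add: test_fun_def)
    have "fun_dist UNIV (\<lambda>x. u (dil a c x)) (Dalpha \<alpha> \<phi>) =
        (\<integral>x. Dalpha \<alpha> \<phi> x *\<^sub>R u (dil a c x) \<partial>lborel)"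
      using fun_dist_derivs[OF \<phi> u'] by (simp add: Dalpha_def)
    also have "\<dots> = (\<integral>x. \<kappa> *\<^sub>R (Dalpha \<alpha> \<psi> (dil a c x) *\<^sub>R u (dil a c x)) \<partial>lborel)"
      by (subst \<phi>_eq) (simp add: Dalpha_dil[OF \<psi>'] \<kappa>[OF that])
    also have "\<dots> = \<kappa> *\<^sub>R (\<integral>x. Dalpha \<alpha> \<psi> (dil a c x) *\<^sub>R u (dil a c x) \<partial>lborel)"
      by (rule integral_scaleR_right)
    also have "(\<integral>x. Dalpha \<alpha> \<psi> x *\<^sub>R u x \<partial>lborel) =
        D *\<^sub>R (\<integral>x. Dalpha \<alpha> \<psi> (dil a c x) *\<^sub>R u (dil a c x) \<partial>lborel)"
      unfolding D_def Dalpha_def by (rule integral_dil[OF test_fun_derivs(1)[OF \<psi> u] c])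
    then have "(\<integral>x. Dalpha \<alpha> \<psi> (dil a c x) *\<^sub>R u (dil a c x) \<partial>lborel) =
        (1 / D) *\<^sub>R (\<integral>x. Dalpha \<alpha> \<psi> x *\<^sub>R u x \<partial>lborel)"
      using D by simp
    also have "(\<integral>x. Dalpha \<alpha> \<psi> x *\<^sub>R u x \<partial>lborel) = fun_dist UNIV u (Dalpha \<alpha> \<psi>)"
      using fun_dist_derivs[OF \<psi> u] by (simp add: Dalpha_def)
    finally show ?thesis by simp
  qed
  let ?S = "\<lambda>h \<phi>. \<Sum>\<alpha>\<in>{\<alpha>. P \<alpha> \<noteq> 0}. (-1) ^ mi_order \<alpha> *\<^sub>R (P \<alpha> *v fun_dist UNIV h (Dalpha \<alpha> \<phi>))"
  have "?S (\<lambda>x. u (dil a c x)) \<phi> = (\<kappa> / D) *\<^sub>R ?S u \<psi>"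
    by (simp add: fd scaleR_sum_right matrix_vector_mult_scaleR mult.commute)
  also have "\<dots> = 0"
    using sol \<psi> by (simp add: dist_solution_def)
  finally show "?S (\<lambda>x. u (dil a c x)) \<phi> = 0" .
qed

text \<open>A continuous function is a distribution of order 0: on K the constant is the integral of
  \<open>norm (v x)\<close> over K, and only the empty list of derivatives is needed.\<close>

lemma vdistribution_fun_dist:
  fixes v :: "real^'n::finite \<Rightarrow> real^'m::finite"
  assumes v: "continuous_on UNIV v"
  shows "vdistribution UNIV (fun_dist UNIV v)"
  unfolding vdistribution_def distribution_def
proof (intro allI conjI impI)
  fix j and \<phi> \<psi> :: "real^'n \<Rightarrow> real" and a b
  assume \<phi>: "test_fun UNIV \<phi>" and \<psi>: "test_fun UNIV \<psi>"
  have i: "(\<lambda>x. \<phi> x *\<^sub>R v x) integrable_on UNIV" "(\<lambda>x. \<psi> x *\<^sub>R v x) integrable_on UNIV"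
    using test_fun_derivs(2)[OF \<phi> v, of "[]"] test_fun_derivs(2)[OF \<psi> v, of "[]"]
    by (auto intro: has_integral_integrable[OF has_integral_integral_lborel])
  have "fun_dist UNIV v (\<lambda>x. a * \<phi> x + b * \<psi> x) =
      integral UNIV (\<lambda>x. a *\<^sub>R (\<phi> x *\<^sub>R v x) + b *\<^sub>R (\<psi> x *\<^sub>R v x))"
    by (simp add: fun_dist_def algebra_simps)
  also have "\<dots> = a *\<^sub>R fun_dist UNIV v \<phi> + b *\<^sub>R fun_dist UNIV v \<psi>"
    unfolding fun_dist_def using i
    by (simp add: Henstock_Kurzweil_Integration.integral_add integrable_cmul del: scaleR_scaleR)
  finally show "fun_dist UNIV v (\<lambda>x. a * \<phi> x + b * \<psi> x) $ j =
      a * fun_dist UNIV v \<phi> $ j + b * fun_dist UNIV v \<psi> $ j"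
    by simp
next
  fix j and K :: "(real^'n) set"
  assume K: "compact K \<and> K \<subseteq> UNIV"
  define I where "I = (\<integral>x. indicator K x *\<^sub>R norm (v x) \<partial>lborel)"
  have vK: "integrable lborel (\<lambda>x. indicator K x *\<^sub>R norm (v x))"
    using K v by (intro borel_integrable_compact) (auto intro: continuous_intros continuous_on_subset)
  have "\<bar>fun_dist UNIV v \<phi> $ j\<bar> \<le> I * (\<Sum>ds\<in>{ds. length ds \<le> 0}. SUP x. \<bar>derivs ds \<phi> x\<bar>)"
    if \<phi>: "test_fun UNIV \<phi>" and s: "tsupp \<phi> \<subseteq> K" for \<phi>
  proof -
    have \<phi>0: "\<phi> x = 0" if "x \<notin> K" for x
      using derivs_eq_0_outside_tsupp[of x \<phi> "[]"] s that by auto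
    \<comment> \<open>The supremum bounds the values of \<phi> only once the range is known to be
      bounded above; compactness of K supplies this.\<close>
    have "compact (\<phi> ` K)"
      using \<phi> K by (intro compact_continuous_image)
        (auto simp: test_fun_def intro: continuous_on_subset[OF smooth_on_UNIV_continuous])
    then obtain B where B: "\<And>x. x \<in> K \<Longrightarrow> \<bar>\<phi> x\<bar> \<le> B"
      by (metis bounded_iff compact_imp_bounded imageI real_norm_def)
    have "\<bar>\<phi> x\<bar> \<le> max B 0" for x
      using B[of x] \<phi>0[of x] by (cases "x \<in> K") auto
    then have "bdd_above (range (\<lambda>x. \<bar>\<phi> x\<bar>))"
      by (intro bdd_aboveI2)
    then have le: "\<bar>\<phi> x\<bar> \<le> (SUP x. \<bar>\<phi> x\<bar>)" for x
      by (rule cSUP_upper[rotated]) simp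
    have "norm (fun_dist UNIV v \<phi>) = norm (\<integral>x. \<phi> x *\<^sub>R v x \<partial>lborel)"
      using fun_dist_derivs[OF \<phi> v, of "[]"] by simp
    also have "\<dots> \<le> (\<integral>x. (SUP x. \<bar>\<phi> x\<bar>) * (indicator K x *\<^sub>R norm (v x)) \<partial>lborel)"
    proof (rule Bochner_Integration.integral_norm_bound_integral)
      show "integrable lborel (\<lambda>x. \<phi> x *\<^sub>R v x)"
        using test_fun_derivs(2)[OF \<phi> v, of "[]"] by simp
      show "norm (\<phi> x *\<^sub>R v x) \<le> (SUP x. \<bar>\<phi> x\<bar>) * (indicator K x *\<^sub>R norm (v x))" for x
        using \<phi>0 mult_right_mono[OF le[of x], of "norm (v x)"] by (cases "x \<in> K") auto
    qed (use vK in simp)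
    also have "\<dots> = I * (SUP x. \<bar>\<phi> x\<bar>)"
      by (simp add: I_def)
    finally show ?thesis
      using component_le_norm_cart[of "fun_dist UNIV v \<phi>" j] by simp
  qed
  then show "\<exists>C m. \<forall>\<phi>. test_fun UNIV \<phi> \<and> tsupp \<phi> \<subseteq> K \<longrightarrow>
      \<bar>fun_dist UNIV v \<phi> $ j\<bar> \<le> C * (\<Sum>ds\<in>{ds. length ds \<le> m}. SUP x. \<bar>derivs ds \<phi> x\<bar>)"
    by blast
qed

subsection \<open>Bump functions\<close>

text \<open>The polynomial factor makes the family generated by exp(-1/x) closed under
  differentiation.\<close>

definition exp_bump :: "real poly \<Rightarrow> real \<Rightarrow> real" where
  "exp_bump p x = (if x > 0 then poly p (1 / x) * exp (- (1 / x)) else 0)"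

lemma poly_times_exp_minus_tendsto_0: "((\<lambda>y. poly p y * exp (- y)) \<longlongrightarrow> (0::real)) at_top"
proof -
  have "((\<lambda>y. \<Sum>i\<le>degree p. coeff p i * (y ^ i / exp y)) \<longlongrightarrow> (0::real)) at_top"
    by (intro tendsto_null_sum tendsto_mult_right_zero tendsto_power_div_exp_0)
  then show ?thesis
    by (simp add: poly_altdef exp_minus sum_distrib_right divide_inverse mult.assoc)
qed

text \<open>With y = 1/x, differentiation in x is -y^2 d/dy, which sends p(y) exp(-y) to y^2 (p -
  p')(y) exp(-y); \<open>[:0, 0, 1:]\<close> is y^2.\<close>

lemma exp_bump_has_derivative:
  "(exp_bump p has_real_derivative exp_bump ([:0, 0, 1:] * (p - pderiv p)) x) (at x)"
proof -
  consider "x > 0" | "x < 0" | "x = 0" by linarith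
  then show ?thesis
  proof cases
    case 1
    have "((\<lambda>x. poly p (1 / x) * exp (- (1 / x))) has_real_derivative
        exp_bump ([:0, 0, 1:] * (p - pderiv p)) x) (at x)"
      using 1
      by (auto intro!: derivative_eq_intros simp: exp_bump_def power2_eq_square field_simps)
    then show ?thesis
      by (rule has_field_derivative_transform_within_open[where S = "{0<..}"])
        (use 1 in \<open>auto simp: exp_bump_def\<close>)
  next
    case 2
    have "((\<lambda>x. 0) has_real_derivative exp_bump ([:0, 0, 1:] * (p - pderiv p)) x) (at x)"
      using 2 by (auto simp: exp_bump_def)
    then show ?thesis
      by (rule has_field_derivative_transform_within_open[where S = "{..<0}"])
        (use 2 in \<open>auto simp: exp_bump_def\<close>)
  next
    case 3
    have "((\<lambda>h. exp_bump p h / h) \<longlongrightarrow> 0) (at_right 0)"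
    proof -
      \<comment> \<open>Dividing by h multiplies p by y = 1/h, so the difference quotient is again a
        polynomial in y times exp(-y).\<close>
      have "((\<lambda>h. poly ([:0, 1:] * p) (inverse h) * exp (- inverse h)) \<longlongrightarrow> (0::real)) (at_right 0)"
        by (rule filterlim_compose[OF poly_times_exp_minus_tendsto_0 filterlim_inverse_at_top_right])
      then show ?thesis
        by (rule Lim_transform_eventually)
          (auto simp: eventually_at_right_less exp_bump_def field_simps eventually_at_filter)
    qed
    moreover have "((\<lambda>h. exp_bump p h / h) \<longlongrightarrow> 0) (at_left 0)"
      by (rule tendsto_eventually) (auto simp: exp_bump_def eventually_at_filter)
    ultimately have "((\<lambda>h. exp_bump p h / h) \<longlongrightarrow> 0) (at 0)"
      by (simp add: filterlim_at_split)
    then show ?thesis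
      using 3 by (simp add: has_field_derivative_iff exp_bump_def)
  qed
qed

text \<open>A class closed under differentiation that contains the bump. Differences suffice: the
  product rule gives two products, and the reflected factor in 1 - x contributes the minus
  sign.\<close>

inductive_set bump_span :: "(real \<Rightarrow> real) set" where
  prod: "(\<lambda>x. exp_bump p (1 + x) * exp_bump q (1 - x)) \<in> bump_span"
| diff: "f \<in> bump_span \<Longrightarrow> g \<in> bump_span \<Longrightarrow> (\<lambda>x. f x - g x) \<in> bump_span"

lemma bump_span_derivative:
  "f \<in> bump_span \<Longrightarrow> \<exists>g\<in>bump_span. \<forall>x. (f has_real_derivative g x) (at x)"
proof (induction rule: bump_span.induct)
  case (prod p q)
  let ?D = "\<lambda>p. [:0, 0, 1:] * (p - pderiv p)"
  have "((\<lambda>x. exp_bump p (1 + x)) has_real_derivative exp_bump (?D p) (1 + x)) (at x)" for x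
    by (rule DERIV_chain2[OF exp_bump_has_derivative, THEN DERIV_cong])
      (auto intro!: derivative_eq_intros)
  moreover have "((\<lambda>x. exp_bump q (1 - x)) has_real_derivative - exp_bump (?D q) (1 - x)) (at x)" for x
    by (rule DERIV_chain2[OF exp_bump_has_derivative, THEN DERIV_cong])
      (auto intro!: derivative_eq_intros)
  ultimately have "((\<lambda>x. exp_bump p (1 + x) * exp_bump q (1 - x)) has_real_derivative
      exp_bump (?D p) (1 + x) * exp_bump q (1 - x) - exp_bump p (1 + x) * exp_bump (?D q) (1 - x)) (at x)" for x
    by (auto intro!: derivative_eq_intros simp: algebra_simps)
  then show ?case
    by (intro bexI[OF _ bump_span.diff[OF bump_span.prod bump_span.prod]] allI)
next
  case (diff f g)
  then obtain f' g' where "f' \<in> bump_span" "g' \<in> bump_span"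
    "\<forall>x. (f has_real_derivative f' x) (at x)" "\<forall>x. (g has_real_derivative g' x) (at x)"
    by blast
  then show ?case
    by (intro bexI[of _ "\<lambda>x. f' x - g' x"]) (auto intro: bump_span.diff derivative_intros)
qed

text \<open>Delivering the whole sequence of derivatives lets every mixed derivative of a product of
  such bumps be written in closed form.\<close>

lemma exists_smooth_bump_real:
  obtains G :: "nat \<Rightarrow> real \<Rightarrow> real" where
    "\<And>m x. (G m has_real_derivative G (Suc m) x) (at x)"
    "\<And>x. G 0 x \<ge> 0" "\<And>x. \<bar>x\<bar> < 1 \<Longrightarrow> G 0 x > 0" "\<And>x. \<bar>x\<bar> \<ge> 1 \<Longrightarrow> G 0 x = 0"
proof -
  define b where "b = (\<lambda>x. exp_bump [:1:] (1 + x) * exp_bump [:1:] (1 - x))"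
  define G where "G m = (deriv ^^ m) b" for m
  have D: "deriv f \<in> bump_span \<and> (\<forall>x. (f has_real_derivative deriv f x) (at x))"
    if "f \<in> bump_span" for f
  proof -
    from bump_span_derivative[OF that]
    obtain g where g: "g \<in> bump_span" "\<forall>x. (f has_real_derivative g x) (at x)"
      by blast
    then have "deriv f = g" using DERIV_imp_deriv by blast
    with g show ?thesis by simp
  qed
  have "G m \<in> bump_span" for m
    by (induction m) (use D in \<open>auto simp: G_def b_def bump_span.prod\<close>)
  then have "(G m has_real_derivative G (Suc m) x) (at x)" for m x
    using D by (simp add: G_def)
  moreover have "G 0 x \<ge> 0" "\<bar>x\<bar> < 1 \<Longrightarrow> G 0 x > 0" "\<bar>x\<bar> \<ge> 1 \<Longrightarrow> G 0 x = 0" for x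
    by (auto simp: G_def b_def exp_bump_def)
  ultimately show ?thesis using that by blast
qed

lemma has_vector_derivative_prod_axis:
  fixes x :: "real^'n::finite"
  assumes G: "\<And>m s. (G m has_real_derivative G (Suc m) s) (at s)"
  shows "((\<lambda>t. \<Prod>j\<in>UNIV. G (k j) ((x + t *\<^sub>R axis i 1) $ j)) has_vector_derivative
    (\<Prod>j\<in>UNIV. G (if j = i then Suc (k j) else k j) (x $ j))) (at (0::real))"
proof -
  let ?R = "\<Prod>j\<in>UNIV - {i}. G (k j) (x $ j)"
  have "((\<lambda>t. G (k i) (x $ i + t) * ?R) has_real_derivative G (Suc (k i)) (x $ i) * ?R) (at 0)"
    using DERIV_at_within_shift[of "G (k i)" "G (Suc (k i)) (x $ i)" "x $ i" 0 UNIV] G[of "k i" "x $ i"]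
    by (intro DERIV_cmult_right) simp
  moreover have "(\<Prod>j\<in>UNIV. G (k j) ((x + t *\<^sub>R axis i 1) $ j)) = G (k i) (x $ i + t) * ?R" for t
    by (simp add: prod.remove[of UNIV i] axis_def)
  moreover have "(\<Prod>j\<in>UNIV. G (if j = i then Suc (k j) else k j) (x $ j)) = G (Suc (k i)) (x $ i) * ?R"
    by (simp add: prod.remove[of UNIV i])
  ultimately show ?thesis
    by (simp add: has_real_derivative_iff_has_vector_derivative)
qed

lemma exists_bump_test_fun:
  obtains b :: "real^'n::finite \<Rightarrow> real" where
    "test_fun UNIV b" "\<And>x. b x \<ge> 0" "b 0 > 0" "\<And>x. b x \<noteq> 0 \<Longrightarrow> (\<forall>i. \<bar>x $ i\<bar> < 1)"
proof -
  obtain G :: "nat \<Rightarrow> real \<Rightarrow> real" where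
    G: "\<And>m x. (G m has_real_derivative G (Suc m) x) (at x)"
    and nn: "\<And>x. G 0 x \<ge> 0" and pos: "\<And>x. \<bar>x\<bar> < 1 \<Longrightarrow> G 0 x > 0"
    and out: "\<And>x. \<bar>x\<bar> \<ge> 1 \<Longrightarrow> G 0 x = 0"
    using exists_smooth_bump_real by blast
  define b where "b = (\<lambda>x::real^'n. \<Prod>j\<in>UNIV. G 0 (x $ j))"
  have db: "derivs ds b = (\<lambda>x. \<Prod>j\<in>UNIV. G (count_list ds j) (x $ j))" for ds
  proof (induction ds)
    case (Cons i ds)
    have "partial i (derivs ds b) x =
        (\<Prod>j\<in>UNIV. G (if j = i then Suc (count_list ds j) else count_list ds j) (x $ j))" for x
      unfolding Cons
      by (rule partial_eq_of_has_vector_derivative[OF has_vector_derivative_prod_axis[where G=G, OF G]])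
    moreover have "count_list (i # ds) j = (if j = i then Suc (count_list ds j) else count_list ds j)" for j
      by auto
    ultimately show ?case by (auto intro!: ext simp del: count_list.simps)
  qed (simp add: b_def)
  have cG: "continuous_on UNIV (G m)" for m
    using G by (intro DERIV_continuous_on) (auto intro: has_field_derivative_at_within)
  have "smooth_on UNIV b"
  proof (rule smooth_on_UNIV_I)
    fix ds
    show "continuous_on UNIV (derivs ds b)"
      unfolding db by (intro continuous_intros continuous_on_compose2[OF cG]) auto
    show "((\<lambda>t. derivs ds b (x + t *\<^sub>R axis i 1)) has_vector_derivative
        (\<Prod>j\<in>UNIV. G (if j = i then Suc (count_list ds j) else count_list ds j) (x $ j))) (at 0)" for i x
      unfolding db by (rule has_vector_derivative_prod_axis[where G=G, OF G])
  qed
  moreover have sup: "\<bar>x $ i\<bar> < 1" if "b x \<noteq> 0" for x i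
    using that out[of "x $ i"] unfolding b_def by (metis UNIV_I finite not_less prod_zero)
  moreover have "compact (tsupp b)"
  proof -
    have "{x. b x \<noteq> 0} \<subseteq> cbox (\<chi> i. -1) (\<chi> i. 1)"
      using sup by (auto simp: mem_box_cart abs_less_iff less_imp_le minus_le_iff)
    then have "tsupp b \<subseteq> cbox (\<chi> i. -1) (\<chi> i. 1)"
      unfolding tsupp_def by (rule closure_minimal) (rule closed_cbox)
    moreover have "closed (tsupp b)" by (simp add: tsupp_def)
    ultimately show ?thesis
      using compact_Int_closed[OF compact_cbox[of "\<chi> i. - 1" "\<chi> i. 1"], of "tsupp b"]
      by (simp add: Int_absorb1)
  qed
  moreover have "b x \<ge> 0" for x using nn by (simp add: b_def prod_nonneg)
  moreover have "b 0 > 0" using pos by (simp add: b_def prod_pos)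
  ultimately show ?thesis using that by (simp add: test_fun_def)
qed

text \<open>The fundamental lemma of the calculus of variations: a nonnegative bump near a point of
  disagreement detects the difference.\<close>

lemma eq_of_fun_dist_eq:
  fixes f g :: "real^'n::finite \<Rightarrow> real^'m::finite"
  assumes f: "continuous_on UNIV f" and g: "continuous_on UNIV g"
    and eq: "\<And>\<phi>. test_fun UNIV \<phi> \<Longrightarrow> fun_dist UNIV f \<phi> = fun_dist UNIV g \<phi>"
  shows "f = g"
proof (rule ccontr)
  assume "f \<noteq> g"
  then obtain y j where yj: "f y $ j \<noteq> g y $ j" by (auto simp: vec_eq_iff fun_eq_iff)
  \<comment> \<open>Multiplying by the value of the difference at y makes the product positive near
    y, whichever sign the difference has.\<close>
  define k where "k x = (f y $ j - g y $ j) * (f x $ j - g x $ j)" for x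
  have k: "continuous_on UNIV k"
    unfolding k_def by (intro continuous_intros f g)
  have "k y > 0" using yj by (auto simp: k_def zero_less_mult_iff)
  then obtain r where r: "r > 0" "\<And>x. dist x y < r \<Longrightarrow> k x > 0"
  proof -
    have "open (k -` {0<..})" using k by (auto intro: open_vimage simp: continuous_on_eq_continuous_at)
    then show ?thesis using that \<open>k y > 0\<close> by (auto simp: open_dist)
  qed
  \<comment> \<open>Chosen so that the closed cube of half-side \<delta> lies in the open ball of
    radius r, by the l1 bound on the norm; the added 1 gives strictness.\<close>
  define \<delta> where "\<delta> = r / (real CARD('n) + 1)"
  have \<delta>: "\<delta> > 0" using r by (simp add: \<delta>_def add_pos_pos)
  have near: "k x > 0" if "\<And>i. \<bar>x $ i - y $ i\<bar> \<le> \<delta>" for x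
  proof (rule r(2))
    have "dist x y \<le> (\<Sum>i\<in>UNIV. \<bar>(x - y) $ i\<bar>)"
      unfolding dist_norm by (rule norm_le_l1_cart)
    also have "\<dots> \<le> real CARD('n) * \<delta>"
      using sum_bounded_above[of UNIV "\<lambda>i. \<bar>(x - y) $ i\<bar>" \<delta>] that by simp
    also have "\<dots> < r" using r by (simp add: \<delta>_def field_simps)
    finally show "dist x y < r" .
  qed
  obtain b :: "real^'n \<Rightarrow> real" where b: "test_fun UNIV b" "\<And>x. b x \<ge> 0" "b 0 > 0"
    "\<And>x. b x \<noteq> 0 \<Longrightarrow> (\<forall>i. \<bar>x $ i\<bar> < 1)"
    using exists_bump_test_fun by blast
  define \<phi> where "\<phi> = (\<lambda>x. b (dil (\<chi> i. - y $ i / \<delta>) (\<chi> i. 1 / \<delta>) x))"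
  have \<phi>: "test_fun UNIV \<phi>"
    unfolding \<phi>_def using b(1) \<delta> by (intro test_fun_dil) auto
  have c\<phi>: "continuous_on UNIV \<phi>" using \<phi> by (auto simp: test_fun_def intro: smooth_on_UNIV_continuous)
  have \<phi>_supp: "\<bar>x $ i - y $ i\<bar> \<le> \<delta>" if "\<phi> x \<noteq> 0" for x i
  proof -
    have "\<bar>- y $ i / \<delta> + x $ i / \<delta>\<bar> < 1"
      using b(4)[OF that[unfolded \<phi>_def]] by simp
    also have "- y $ i / \<delta> + x $ i / \<delta> = (x $ i - y $ i) / \<delta>" by (simp add: diff_divide_distrib)
    finally show ?thesis using \<delta> by simp
  qed
  let ?B = "cbox (\<chi> i. y $ i - \<delta>) (\<chi> i. y $ i + \<delta>)"
  have mem: "x \<in> ?B \<longleftrightarrow> (\<forall>i. \<bar>x $ i - y $ i\<bar> \<le> \<delta>)" for x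
    by (auto simp: mem_box_cart abs_le_iff algebra_simps)
  have int: "(\<lambda>x. \<phi> x *\<^sub>R h x) integrable_on UNIV" if "continuous_on UNIV h" for h :: "real^'n \<Rightarrow> real^'m"
  proof -
    have "continuous_on UNIV (\<lambda>x. \<phi> x *\<^sub>R h x)" by (intro continuous_intros c\<phi> that)
    moreover have "compact (tsupp \<phi>)" using \<phi> by (simp add: test_fun_def)
    ultimately have "integrable lborel (\<lambda>x. \<phi> x *\<^sub>R h x)"
      by (rule integral_compact_support) (use derivs_eq_0_outside_tsupp[of _ \<phi> "[]"] in simp)
    then show ?thesis by (rule has_integral_integrable[OF has_integral_integral_lborel])
  qed
  have "integral UNIV (\<lambda>x. \<phi> x *\<^sub>R (f x - g x)) = 0"
    using eq[OF \<phi>] int[OF f] int[OF g]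
    by (simp add: fun_dist_def scaleR_diff_right Henstock_Kurzweil_Integration.integral_diff)
  moreover have "(\<lambda>x. \<phi> x *\<^sub>R (f x - g x)) integrable_on UNIV"
    by (intro int continuous_intros f g)
  ultimately have "((\<lambda>x. \<phi> x *\<^sub>R (f x - g x)) has_integral 0) UNIV"
    by (simp add: has_integral_integral)
  from has_integral_linear[OF this bounded_linear_vec_nth[of j]]
  have "((\<lambda>x. \<phi> x * (f x $ j - g x $ j)) has_integral 0) UNIV"
    by (simp add: o_def)
  from has_integral_mult_right[OF this, of "f y $ j - g y $ j"]
  have int0: "((\<lambda>x. \<phi> x * k x) has_integral 0) UNIV"
    by (simp add: k_def algebra_simps)
  \<comment> \<open>On the cube the integrand is continuous and nonnegative, so a vanishing integral
    forces it to vanish pointwise.\<close>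
  have restrict: "(\<lambda>x. \<phi> x * k x) = (\<lambda>x. if x \<in> ?B then \<phi> x * k x else 0)"
  proof
    fix x
    show "\<phi> x * k x = (if x \<in> ?B then \<phi> x * k x else 0)"
      using \<phi>_supp[of x] mem[of x] by auto
  qed
  have "((\<lambda>x. if x \<in> ?B then \<phi> x * k x else 0) has_integral 0) UNIV"
    by (rule subst[OF restrict, of "\<lambda>F. (F has_integral 0) UNIV"]) (rule int0)
  then have "((\<lambda>x. \<phi> x * k x) has_integral 0) ?B"
    by (simp only: has_integral_restrict_UNIV)
  then have "integral ?B (\<lambda>x. \<phi> x * k x) = 0" by (rule integral_unique)
  moreover have "box (\<chi> i. y $ i - \<delta>) (\<chi> i. y $ i + \<delta>) \<noteq> {}"
    using \<delta> by (simp add: interval_ne_empty_cart)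
  moreover have "\<phi> x * k x \<ge> 0" if "x \<in> ?B" for x
    using b(2) near[of x] mem[of x] that by (auto simp: \<phi>_def intro!: mult_nonneg_nonneg less_imp_le)
  moreover have "continuous_on ?B (\<lambda>x. \<phi> x * k x)"
    by (intro continuous_intros continuous_on_subset[OF c\<phi>] continuous_on_subset[OF k]) auto
  ultimately have "\<forall>x\<in>?B. \<phi> x * k x = 0"
    using integral_cbox_eq_0_iff by blast
  moreover have "y \<in> ?B" using mem \<delta> by auto
  moreover have "\<phi> y = b 0"
    using \<delta> by (simp add: \<phi>_def vec_eq_iff arg_cong[of _ _ b])
  ultimately show False using \<open>k y > 0\<close> b(3) by auto
qed

subsection \<open>Weighted homogeneous polynomials\<close>

lemma monomials_independent:
  fixes Q :: "('n::finite \<Rightarrow> nat) \<Rightarrow> 'b::real_vector"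
  assumes "finite S" "\<And>x::real^'n. (\<Sum>\<alpha>\<in>S. (\<Prod>i\<in>UNIV. (x $ i) ^ \<alpha> i) *\<^sub>R Q \<alpha>) = 0" "\<alpha> \<in> S"
  shows "Q \<alpha> = 0"
proof -
  define m where "m \<alpha> x = (\<Prod>i\<in>UNIV. (x $ i) ^ \<alpha> i)" for \<alpha> and x :: "real^'n"
  have mult: "m \<alpha> (\<chi> j. x $ j * y $ j) = m \<alpha> x * m \<alpha> y" for \<alpha> x y
    by (simp add: m_def power_mult_distrib prod.distrib)
  (* Dedekind's argument: distinct multiplicative characters are linearly independent. *)
  have "(\<And>x. (\<Sum>\<alpha>\<in>S. m \<alpha> x *\<^sub>R Q \<alpha>) = 0) \<Longrightarrow> \<alpha> \<in> S \<Longrightarrow> Q \<alpha> = 0"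
    using assms(1)
  proof (induction S arbitrary: Q \<alpha> rule: finite_induct)
    case (insert \<beta> S)
    have sum0: "m \<beta> x *\<^sub>R Q \<beta> + (\<Sum>\<alpha>\<in>S. m \<alpha> x *\<^sub>R Q \<alpha>) = 0" for x
      using insert.prems(1)[of x] insert.hyps by simp
    have S: "Q \<gamma> = 0" if "\<gamma> \<in> S" for \<gamma>
    proof -
      have "\<gamma> \<noteq> \<beta>" using that insert.hyps by auto
      then obtain i where i: "\<gamma> i \<noteq> \<beta> i" by blast
      \<comment> \<open>Doubling one coordinate on which \<gamma> and \<beta> differ separates the
        two characters. Subtracting \<open>m \<beta> y\<close> times the relation at x from the
        relation at the product of x and y eliminates \<beta>.\<close>
      define y :: "real^'n" where "y = (\<chi> j. if j = i then 2 else 1)"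
      have my: "m \<alpha> y = 2 ^ \<alpha> i" for \<alpha>
        by (simp add: m_def y_def prod.remove[of UNIV i])
      have "(\<Sum>\<alpha>\<in>S. m \<alpha> x *\<^sub>R ((m \<alpha> y - m \<beta> y) *\<^sub>R Q \<alpha>)) = 0" for x
      proof -
        have "(\<Sum>\<alpha>\<in>S. m \<alpha> x *\<^sub>R ((m \<alpha> y - m \<beta> y) *\<^sub>R Q \<alpha>)) =
            (\<Sum>\<alpha>\<in>S. (m \<alpha> x * m \<alpha> y) *\<^sub>R Q \<alpha> - m \<beta> y *\<^sub>R (m \<alpha> x *\<^sub>R Q \<alpha>))"
          by (intro sum.cong refl) (simp add: algebra_simps)
        also have "\<dots> = (\<Sum>\<alpha>\<in>S. m \<alpha> (\<chi> j. x $ j * y $ j) *\<^sub>R Q \<alpha>)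
            - m \<beta> y *\<^sub>R (\<Sum>\<alpha>\<in>S. m \<alpha> x *\<^sub>R Q \<alpha>)"
          by (simp only: mult sum_subtractf scaleR_sum_right)
        also have "\<dots> = - (m \<beta> (\<chi> j. x $ j * y $ j) *\<^sub>R Q \<beta>) + m \<beta> y *\<^sub>R (m \<beta> x *\<^sub>R Q \<beta>)"
          using sum0[of x] sum0[of "\<chi> j. x $ j * y $ j"]
          by (simp only: add_eq_0_iff scaleR_minus_right) simp
        also have "\<dots> = 0" by (simp add: mult mult.commute)
        finally show ?thesis .
      qed
      then have "(m \<gamma> y - m \<beta> y) *\<^sub>R Q \<gamma> = 0"
        using insert.IH[of "\<lambda>\<alpha>. (m \<alpha> y - m \<beta> y) *\<^sub>R Q \<alpha>" \<gamma>] that by blast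
      then show ?thesis using i by (simp add: my)
    qed
    have "m \<beta> (\<chi> i. 1) *\<^sub>R Q \<beta> = 0"
      using sum0[of "\<chi> i. 1"] S by simp
    then have "Q \<beta> = 0" by (simp add: m_def)
    with S insert.prems show ?case by auto
  qed simp
  then show ?thesis using assms by (simp add: m_def)
qed

text \<open>Comparison of coefficients: the identity says that a polynomial with coefficients
  (c^\<alpha> - \<kappa>) \<open>P \<alpha>\<close> vanishes everywhere.\<close>

lemma weighted_homogeneous_monomials:
  fixes P :: "('n::finite \<Rightarrow> nat) \<Rightarrow> real^'m::finite^'k::finite"
  assumes "poly_coeffs P"
    and hom: "\<And>x. poly_eval P (\<chi> i. c $ i * x $ i) = \<kappa> *\<^sub>R poly_eval P x"
    and "P \<alpha> \<noteq> 0"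
  shows "(\<Prod>i\<in>UNIV. (c $ i) ^ \<alpha> i) = \<kappa>"
proof -
  have "(\<Sum>\<alpha>\<in>{\<alpha>. P \<alpha> \<noteq> 0}. (\<Prod>i\<in>UNIV. (x $ i) ^ \<alpha> i) *\<^sub>R
      (((\<Prod>i\<in>UNIV. (c $ i) ^ \<alpha> i) - \<kappa>) *\<^sub>R P \<alpha>)) = 0" for x :: "real^'n"
  proof -
    have "(\<Sum>\<alpha>\<in>{\<alpha>. P \<alpha> \<noteq> 0}. (\<Prod>i\<in>UNIV. (x $ i) ^ \<alpha> i) *\<^sub>R
        (((\<Prod>i\<in>UNIV. (c $ i) ^ \<alpha> i) - \<kappa>) *\<^sub>R P \<alpha>)) =
        poly_eval P (\<chi> i. c $ i * x $ i) - \<kappa> *\<^sub>R poly_eval P x"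
      unfolding poly_eval_def scaleR_sum_right sum_subtractf[symmetric]
      by (intro sum.cong refl) (simp add: power_mult_distrib prod.distrib algebra_simps)
    then show ?thesis by (simp add: hom)
  qed
  then have "((\<Prod>i\<in>UNIV. (c $ i) ^ \<alpha> i) - \<kappa>) *\<^sub>R P \<alpha> = 0"
    using assms(1,3)
    by (intro monomials_independent[where S = "{\<alpha>. P \<alpha> \<noteq> 0}"
        and Q = "\<lambda>\<alpha>. ((\<Prod>i\<in>UNIV. (c $ i) ^ \<alpha> i) - \<kappa>) *\<^sub>R P \<alpha>"]) (auto simp: poly_coeffs_def)
  then show ?thesis using assms(3) by simp
qed

subsection \<open>Lacunary series\<close>

text \<open>Serves on both sides of the contradiction: it bounds the increments of g from above, and
  it is the property that the series violates.\<close>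

lemma differentiable_imp_local_linear_bound:
  fixes f :: "real \<Rightarrow> 'a::real_normed_vector"
  assumes "f differentiable (at 0)"
  obtains K r where "K > 0" "r > 0" "\<And>s. \<bar>s\<bar> < r \<Longrightarrow> norm (f s - f 0) \<le> K * \<bar>s\<bar>"
proof -
  obtain D where "(f has_vector_derivative D) (at 0)"
    using assms vector_derivative_works by blast
  then have "(f has_derivative (\<lambda>s. s *\<^sub>R D)) (at 0)"
    by (simp add: has_vector_derivative_def)
  then have "\<forall>e>0. \<exists>d>0. \<forall>y. norm (y - 0) < d \<longrightarrow> norm (f y - f 0 - (y - 0) *\<^sub>R D) \<le> e * norm (y - 0)"
    unfolding has_derivative_at_alt by blast
  then obtain r where r: "r > 0"
    "\<And>y. norm (y - 0) < r \<Longrightarrow> norm (f y - f 0 - (y - 0) *\<^sub>R D) \<le> 1 * norm (y - 0)"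
    using zero_less_one by blast
  have "norm (f s - f 0) \<le> (1 + norm D) * \<bar>s\<bar>" if "\<bar>s\<bar> < r" for s
    using r(2)[of s] that norm_triangle_sub[of "f s - f 0" "s *\<^sub>R D"] by (simp add: algebra_simps)
  then show ?thesis using that[of "1 + norm D" r] r(1) by (simp add: add_pos_nonneg)
qed

text \<open>At s0 / R^n the term of index n has the full increment \<epsilon>^n \<delta>, and the
  other terms together cancel at most half of it. The difference quotient there is thus at least a
  constant times (\<epsilon> R)^n, and \<epsilon> R = q > 1.\<close>

lemma lacunary_series_not_differentiable:
  fixes g :: "real \<Rightarrow> 'a::banach"
  assumes bounded: "\<And>s. norm (g s) \<le> M"
    and diff: "g differentiable (at 0)"
    and nonconst: "g s0 \<noteq> g 0"
  obtains \<epsilon> R where "0 < \<epsilon>" "\<epsilon> < 1" "0 < R"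
    "\<not> (\<lambda>s. \<Sum>k. \<epsilon> ^ k *\<^sub>R g (R ^ k * s)) differentiable (at 0)"
proof -
  define B where "B = 2 * M"
  define G where "G s = g s - g 0" for s
  define \<delta> where "\<delta> = norm (G s0)"
  have GB: "norm (G s) \<le> B" for s
    using norm_triangle_ineq4[of "g s" "g 0"] bounded[of s] bounded[of 0] by (simp add: G_def B_def)
  have \<delta>: "\<delta> > 0" using nonconst by (simp add: \<delta>_def G_def)
  have B: "B > 0" using GB[of s0] \<delta> unfolding \<delta>_def by linarith
  have s0: "s0 \<noteq> 0" using nonconst by auto
  \<comment> \<open>Boundedness makes the local linear bound global: where |s| \<ge> r, the trivial
    bound B is at most (B / r) |s|.\<close>
  obtain K where K: "K > 0" "\<And>s. norm (G s) \<le> K * \<bar>s\<bar>"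
  proof -
    obtain K r where r: "K > 0" "r > 0" "\<And>s. \<bar>s\<bar> < r \<Longrightarrow> norm (g s - g 0) \<le> K * \<bar>s\<bar>"
      using differentiable_imp_local_linear_bound[OF diff] by blast
    have "norm (G s) \<le> (K + B / r) * \<bar>s\<bar>" for s
    proof (cases "\<bar>s\<bar> < r")
      case True
      have "0 \<le> B / r * \<bar>s\<bar>" using r B by simp
      then show ?thesis using r(3)[OF True] unfolding G_def distrib_right by linarith
    next
      case False
      have "B * r \<le> B * \<bar>s\<bar>" using B False by (intro mult_left_mono) auto
      then have "B \<le> B / r * \<bar>s\<bar>" using r by (simp add: field_simps)
      moreover have "0 \<le> K * \<bar>s\<bar>" using r by simp
      ultimately show ?thesis using GB[of s] unfolding distrib_right by linarith
    qed
    moreover have "K + B / r > 0" using r B by (simp add: add_pos_pos)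
    ultimately show ?thesis using that by blast
  qed
  (* epsilon makes the tail of the series, and R its initial part, at most epsilon^n * delta / 4 at s0 / R^n. *)
  define \<epsilon> where "\<epsilon> = \<delta> / (\<delta> + 4 * B)"
  define q where "q = 1 + 4 * K * \<bar>s0\<bar> / \<delta>"
  define R where "R = q / \<epsilon>"
  have \<epsilon>: "0 < \<epsilon>" "\<epsilon> < 1" using \<delta> B by (auto simp: \<epsilon>_def field_simps)
  have "1 - \<epsilon> = 4 * B / (\<delta> + 4 * B)"
    using \<delta> B by (simp add: \<epsilon>_def diff_divide_eq_iff)
  then have \<epsilon>B: "B * (\<epsilon> / (1 - \<epsilon>)) = \<delta> / 4" using \<delta> B by (simp add: \<epsilon>_def)
  have q: "q > 1" using \<delta> K s0 by (simp add: q_def)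
  have qK: "K * \<bar>s0\<bar> / (q - 1) = \<delta> / 4" using \<delta> K s0 by (simp add: q_def)
  have R: "R > 0" using q \<epsilon> by (simp add: R_def)
  have R1: "R > 1" using q \<epsilon> by (simp add: R_def field_simps)
  have \<epsilon>R: "\<epsilon> * R = q" using \<epsilon> by (simp add: R_def)
  let ?v = "\<lambda>s. \<Sum>k. \<epsilon> ^ k *\<^sub>R g (R ^ k * s)"
  have summ: "summable (\<lambda>k. \<epsilon> ^ k *\<^sub>R h k)" if "\<And>k. norm (h k) \<le> C" for h :: "nat \<Rightarrow> 'a" and C
  proof (rule summable_comparison_test')
    show "summable (\<lambda>k. C * \<epsilon> ^ k)" using \<epsilon> by (intro summable_mult summable_geometric) auto
    show "norm (\<epsilon> ^ k *\<^sub>R h k) \<le> C * \<epsilon> ^ k" for k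
      using mult_left_mono[OF that[of k], of "\<epsilon> ^ k"] \<epsilon> by (simp add: mult.commute)
  qed
  have lower: "\<epsilon> ^ n * (\<delta> / 2) \<le> norm (?v (s0 / R ^ n) - ?v 0)" for n
  proof -
    let ?a = "\<lambda>k. \<epsilon> ^ k *\<^sub>R G (R ^ k * (s0 / R ^ n))"
    have sa: "summable ?a" by (rule summ[OF GB])
    have "?v (s0 / R ^ n) - ?v 0 = suminf ?a"
      using suminf_diff[OF summ[OF bounded] summ[OF bounded], of "\<lambda>k. R ^ k * (s0 / R ^ n)" "\<lambda>k. R ^ k * 0"]
      by (simp add: G_def scaleR_diff_right)
    also have "\<dots> = (\<Sum>k. ?a (k + Suc n)) + ((\<Sum>k<n. ?a k) + ?a n)"
      using suminf_split_initial_segment[OF sa, of "Suc n"] by simp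
    finally have split: "?v (s0 / R ^ n) - ?v 0 = (\<Sum>k. ?a (k + Suc n)) + ((\<Sum>k<n. ?a k) + ?a n)" .
    have tail: "norm (\<Sum>k. ?a (k + Suc n)) \<le> \<epsilon> ^ n * (\<delta> / 4)"
    proof -
      have "norm (\<Sum>k. ?a (k + Suc n)) \<le> (\<Sum>k. (B * \<epsilon> ^ Suc n) * \<epsilon> ^ k)"
      proof (rule norm_suminf_le)
        show "norm (?a (k + Suc n)) \<le> (B * \<epsilon> ^ Suc n) * \<epsilon> ^ k" for k
          using mult_left_mono[OF GB, of "\<epsilon> ^ (k + Suc n)"] \<epsilon>
          by (simp add: power_add mult_ac)
        show "summable (\<lambda>k. (B * \<epsilon> ^ Suc n) * \<epsilon> ^ k)"
          using \<epsilon> by (intro summable_mult summable_geometric) auto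
      qed
      also have "\<dots> = (B * \<epsilon> ^ Suc n) * (1 / (1 - \<epsilon>))"
        using \<epsilon> by (subst suminf_mult) (auto simp: suminf_geometric summable_geometric)
      also have "\<dots> = \<epsilon> ^ n * (B * (\<epsilon> / (1 - \<epsilon>)))" by simp
      finally show ?thesis by (simp only: \<epsilon>B)
    qed
    have head: "norm (\<Sum>k<n. ?a k) \<le> \<epsilon> ^ n * (\<delta> / 4)"
    proof -
      \<comment> \<open>By the linear bound the term of index k is at most a multiple of (\<epsilon>
        R)^k = q^k, so this is a geometric sum governed by q^n / R^n = \<epsilon>^n.\<close>
      have "norm (\<Sum>k<n. ?a k) \<le> (\<Sum>k<n. (K * \<bar>s0\<bar> / R ^ n) * q ^ k)"
      proof (rule sum_norm_le)
        fix k
        have "norm (?a k) = \<epsilon> ^ k * norm (G (R ^ k * (s0 / R ^ n)))"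
          using \<epsilon> by simp
        also have "\<dots> \<le> \<epsilon> ^ k * (K * \<bar>R ^ k * (s0 / R ^ n)\<bar>)"
          using \<epsilon> by (intro mult_left_mono K(2)) simp
        also have "\<dots> = (K * \<bar>s0\<bar> / R ^ n) * q ^ k"
          using R by (simp add: \<epsilon>R[symmetric] abs_mult power_mult_distrib)
        finally show "norm (?a k) \<le> (K * \<bar>s0\<bar> / R ^ n) * q ^ k" .
      qed
      also have "\<dots> = (K * \<bar>s0\<bar> / R ^ n) * ((q ^ n - 1) / (q - 1))"
        using q unfolding sum_distrib_left[symmetric] by (subst geometric_sum) auto
      also have "\<dots> = (K * \<bar>s0\<bar> / (q - 1)) * ((q ^ n - 1) / R ^ n)" by simp
      also have "\<dots> \<le> (K * \<bar>s0\<bar> / (q - 1)) * (q ^ n / R ^ n)"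
        using K q R by (intro mult_left_mono divide_right_mono) auto
      also have "q ^ n / R ^ n = \<epsilon> ^ n"
        using R by (simp add: \<epsilon>R[symmetric] power_mult_distrib)
      finally show ?thesis by (simp add: qK mult.commute)
    qed
    have "norm (?a n) = \<epsilon> ^ n * \<delta>" using R \<epsilon> by (simp add: \<delta>_def)
    then show ?thesis
      using tail head norm_diff_ineq[of "?a n" "(\<Sum>k. ?a (k + Suc n)) + (\<Sum>k<n. ?a k)"]
        norm_triangle_ineq[of "\<Sum>k. ?a (k + Suc n)" "\<Sum>k<n. ?a k"]
      unfolding split by (simp add: algebra_simps)
  qed
  have "\<not> ?v differentiable (at 0)"
  proof
    assume "?v differentiable (at 0)"
    then obtain C r where C: "C > 0" "r > 0" "\<And>s. \<bar>s\<bar> < r \<Longrightarrow> norm (?v s - ?v 0) \<le> C * \<bar>s\<bar>"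
      using differentiable_imp_local_linear_bound[of ?v] by blast
    \<comment> \<open>N brings s0 / R^n into the range of the linear bound; N' makes q^n exceed what
      the constant C allows.\<close>
    obtain N where N: "\<bar>s0\<bar> / r < R ^ N" using real_arch_pow[OF R1] by blast
    obtain N' where N': "2 * C * \<bar>s0\<bar> / \<delta> < q ^ N'" using real_arch_pow[OF q] by blast
    define n where "n = max N N'"
    have "R ^ N \<le> R ^ n" "q ^ N' \<le> q ^ n"
      using R1 q by (auto simp: n_def intro!: power_increasing)
    then have n: "\<bar>s0\<bar> / r < R ^ n" "2 * C * \<bar>s0\<bar> / \<delta> < q ^ n" using N N' by linarith+
    have "\<bar>s0 / R ^ n\<bar> < r" using n(1) R C(2) by (simp add: field_simps)
    then have "\<epsilon> ^ n * (\<delta> / 2) \<le> C * \<bar>s0 / R ^ n\<bar>"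
      using lower[of n] C(3)[of "s0 / R ^ n"] by linarith
    then have "q ^ n * \<delta> \<le> 2 * C * \<bar>s0\<bar>"
      using R by (simp add: \<epsilon>R[symmetric] field_simps power_mult_distrib)
    then show False using n(2) \<delta> by (simp add: field_simps)
  qed
  with \<epsilon> R show ?thesis using that by blast
qed

subsection \<open>The Liouville theorem\<close>

theorem mainTheorem5:
  fixes P :: "('n::finite \<Rightarrow> nat) \<Rightarrow> real^'m::finite^'k::finite"
    and u :: "real^'n \<Rightarrow> real^'m"
  assumes "poly_coeffs P"
    and "weakly_hypoelliptic P"
    and "weighted_homogeneous P"
    and "u \<in> sol_space P"
    and "bounded (range u)"
  shows "\<exists>c. \<forall>x. u x = c"
proof -
  have smooth: "smooth_on UNIV u" and sol: "dist_solution P UNIV (fun_dist UNIV u)"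
    using assms(4) by (auto simp: sol_space_def)
  have cont: "continuous_on UNIV u" using smooth by (rule smooth_on_UNIV_continuous)
  obtain M where M: "\<And>x. norm (u x) \<le> M"
    using assms(5) by (auto simp: bounded_iff)
  obtain w :: "real^'n" and k where w: "\<And>i. w $ i > 0" and
    hom: "\<And>t x. t > 0 \<Longrightarrow> poly_eval P (\<chi> i. t powr (w $ i) * x $ i) = t powr k *\<^sub>R poly_eval P x"
    using assms(3) unfolding weighted_homogeneous_def by blast
  have axis: "u (a + s *\<^sub>R axis i 1) = u a" for a i s
  proof (rule ccontr)
    assume ne: "u (a + s *\<^sub>R axis i 1) \<noteq> u a"
    define g where "g s = u (a + s *\<^sub>R axis i 1)" for s
    have "((\<lambda>t. derivs [] u (a + t *\<^sub>R axis i 1)) has_vector_derivative partial i (derivs [] u) a) (at 0)"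
      by (rule smooth_on_UNIV_D(2)[OF smooth])
    then have "g differentiable (at 0)"
      unfolding g_def by (auto intro: differentiableI_vector)
    moreover have "norm (g s) \<le> M" for s using M by (simp add: g_def)
    moreover have "g s \<noteq> g 0" using ne by (simp add: g_def)
    ultimately obtain \<epsilon> R where \<epsilon>: "0 < \<epsilon>" "\<epsilon> < 1" and R: "0 < R" and
      nd: "\<not> (\<lambda>s. \<Sum>k. \<epsilon> ^ k *\<^sub>R g (R ^ k * s)) differentiable (at 0)"
        using lacunary_series_not_differentiable[of g M s] by blast
    \<comment> \<open>Solves \<open>t l powr (w $ i) = R ^ l\<close>.\<close>
    define t where "t l = (R ^ l) powr (1 / w $ i)" for l
    define c :: "nat \<Rightarrow> real^'n" where "c l = (\<chi> j. t l powr (w $ j))" for l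
    have t: "t l > 0" for l using R by (simp add: t_def)
    have ci: "c l $ i = R ^ l" for l
      using R w[of i] by (simp add: c_def t_def powr_powr)
    have c0: "c l $ j \<noteq> 0" for l j using t[of l] by (simp add: c_def)
    define U where "U l x = u (dil a (c l) x)" for l x
    have Uc: "continuous_on UNIV (U l)" for l
      unfolding U_def by (rule continuous_on_compose2[OF cont]) (auto intro: continuous_intros)
    have Usol: "dist_solution P UNIV (fun_dist UNIV (U l))" for l
      unfolding U_def
    proof (rule dist_solution_dil[OF sol cont c0])
      show "(\<Prod>j\<in>UNIV. (c l $ j) ^ \<alpha> j) = t l powr k" if "P \<alpha> \<noteq> 0" for \<alpha>
        by (rule weighted_homogeneous_monomials[OF assms(1) _ that])
          (use hom[OF t] in \<open>simp add: c_def\<close>)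
    qed
    define v where "v x = (\<Sum>l. \<epsilon> ^ l *\<^sub>R U l x)" for x
    \<comment> \<open>The majorant M \<epsilon>^l is the same at every x because u is bounded on the
      whole space, however far the dilations reach.\<close>
    have lim: "uniform_limit UNIV (\<lambda>n x. \<Sum>l<n. \<epsilon> ^ l *\<^sub>R U l x) v sequentially"
      unfolding v_def
    proof (rule Weierstrass_m_test)
      show "norm (\<epsilon> ^ l *\<^sub>R U l x) \<le> M * \<epsilon> ^ l" for l x
        using mult_left_mono[OF M, of "\<epsilon> ^ l"] \<epsilon> by (simp add: U_def mult.commute)
      show "summable (\<lambda>l. M * \<epsilon> ^ l)" using \<epsilon> by (intro summable_mult summable_geometric) auto
    qed
    have Sc: "continuous_on UNIV (\<lambda>x. \<Sum>l<n. \<epsilon> ^ l *\<^sub>R U l x)" for n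
      by (intro continuous_intros Uc)
    have vc: "continuous_on UNIV v"
      by (rule uniform_limit_theorem[OF _ lim]) (simp_all add: Sc)
    have "dist_solution P UNIV (fun_dist UNIV v)"
      by (rule dist_solution_uniform_limit[OF dist_solution_sum[OF Usol Uc] Sc lim])
    then obtain f where f: "smooth_on UNIV f"
      "\<And>\<phi>. test_fun UNIV \<phi> \<Longrightarrow> fun_dist UNIV v \<phi> = fun_dist UNIV f \<phi>"
      using assms(2) vdistribution_fun_dist[OF vc] unfolding weakly_hypoelliptic_def
      by (metis open_UNIV)
    have "v = f"
      by (rule eq_of_fun_dist_eq[OF vc smooth_on_UNIV_continuous[OF f(1)] f(2)])
    then have "((\<lambda>t. v (0 + t *\<^sub>R axis i 1)) has_vector_derivative partial i v 0) (at 0)"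
      using smooth_on_UNIV_D(2)[OF f(1), of "[]" 0 i] by simp
    \<comment> \<open>Every dilation maps the axis through 0 to the line through a, so along this
      axis v is exactly the scalar series built from g.\<close>
    moreover have "dil a (c l) (0 + s *\<^sub>R axis i 1) = a + (R ^ l * s) *\<^sub>R axis i 1" for l s
      unfolding dil_add_axis ci by (simp add: vec_eq_iff)
    ultimately have "(\<lambda>s. \<Sum>l. \<epsilon> ^ l *\<^sub>R g (R ^ l * s)) differentiable (at 0)"
      unfolding v_def U_def g_def by (auto intro: differentiableI_vector)
    with nd show False by blast
  qed
  \<comment> \<open>Any point is reached from 0 by changing one coordinate at a time.\<close>
  have "u (\<Sum>i\<in>F. x $ i *\<^sub>R axis i 1) = u 0" if "finite F" for F x
    using that
  proof induction
    case (insert i F)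
    then show ?case using axis[of "\<Sum>i\<in>F. x $ i *\<^sub>R axis i 1" "x $ i" i] by (simp add: add.commute)
  qed simp
  from this[of UNIV] have "u x = u 0" for x
    using basis_expansion[of x] by (metis (no_types, lifting) finite scalar_mult_eq_scaleR sum.cong)
  then show ?thesis by blast
qed

end
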